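(* Let $\mathbb F_q$ be a finite field of characteristic $2$, and let $(C_i\subsetneq\mathbb F_q^n)_{i\in[t]}$ be a collection of proper classical codes with product-expansion at least $\rho>0$. Then there exists $\rho'=\rho'(\rho,t)>0$ depending only on $\rho$ and $t$ such that for every subcode $C_t'\subseteq C_t$, the collection $(C_1,\dots,C_{t-1},C_t')$ has product-expansion at least $\rho'$.
   Context: Product-expansion: For codes $C_1\subseteq\mathbb F_q^{n_1},\dots,C_t\subseteq\mathbb F_q^{n_t}$, identify $\mathbb F_q^{n_1}\otimes\cdots\otimes\mathbb F_q^{n_t}$ with $t$-dimensional arrays; a direction-$i$ column is the vector in $\mathbb F_q^{n_i}$ obtained by fixing all coordinates except the $i$-th. $C^{(i)}$ is the space of arrays all of whose direction-$i$ columns lie in $C_i$, and $C_1\boxplus\cdots\boxplus C_t=C^{(1)}+\cdots+C^{(t)}$. $|c|$ is the number of nonzero entries of an array, $|c|_i$ its number of nonzero direction-$i$ columns. The product-expansion of $(C_i)_{i\in[t]}$ is the largest $\rho\ge0$ such that every $c\in C_1\boxplus\cdots\boxplus C_t$ has a decomposition $c=c_1+\cdots+c_t$ with $c_i\in C^{(i)}$ and $|c|\ge\rho\sum_in_i|c_i|_i$. *)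

theory Defs
  imports "HOL-Algebra.Algebra"
begin

(* Finite fields are HOL-Algebra structures with carrier a set of naturals
   (every finite field is isomorphic to one of these). This lets the
   constant rho' be chosen before the field, i.e. independent of q. *)

definition char_two :: "nat ring \<Rightarrow> bool" where
  "char_two R \<longleftrightarrow> \<one>\<^bsub>R\<^esub> \<oplus>\<^bsub>R\<^esub> \<one>\<^bsub>R\<^esub> = \<zero>\<^bsub>R\<^esub>"

definition vecs :: "nat ring \<Rightarrow> nat \<Rightarrow> (nat \<Rightarrow> nat) set" where
  "vecs R m = {v. (\<forall>j<m. v j \<in> carrier R) \<and> (\<forall>j\<ge>m. v j = \<zero>\<^bsub>R\<^esub>)}"

definition lin_code :: "nat ring \<Rightarrow> nat \<Rightarrow> (nat \<Rightarrow> nat) set \<Rightarrow> bool" where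
  "lin_code R m C \<longleftrightarrow> C \<subseteq> vecs R m \<and> (\<lambda>_. \<zero>\<^bsub>R\<^esub>) \<in> C
     \<and> (\<forall>u\<in>C. \<forall>v\<in>C. (\<lambda>j. u j \<oplus>\<^bsub>R\<^esub> v j) \<in> C)
     \<and> (\<forall>a\<in>carrier R. \<forall>v\<in>C. (\<lambda>j. a \<otimes>\<^bsub>R\<^esub> v j) \<in> C)"

definition positions :: "(nat \<Rightarrow> nat) \<Rightarrow> nat \<Rightarrow> (nat \<Rightarrow> nat) set" where
  "positions ns t = Pi\<^sub>E {..<t} (\<lambda>i. {..<ns i})"

text \<open>The tensor product space F^{n_0} (x) ... (x) F^{n_(t-1)} as arrays, zero outside positions.\<close>
definition arrays :: "nat ring \<Rightarrow> (nat \<Rightarrow> nat) \<Rightarrow> nat \<Rightarrow> ((nat \<Rightarrow> nat) \<Rightarrow> nat) set" where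
  "arrays R ns t = {c. (\<forall>p\<in>positions ns t. c p \<in> carrier R)
                       \<and> (\<forall>p. p \<notin> positions ns t \<longrightarrow> c p = \<zero>\<^bsub>R\<^esub>)}"

definition column :: "nat ring \<Rightarrow> (nat \<Rightarrow> nat) \<Rightarrow> ((nat \<Rightarrow> nat) \<Rightarrow> nat) \<Rightarrow> nat \<Rightarrow> (nat \<Rightarrow> nat) \<Rightarrow> nat \<Rightarrow> nat" where
  "column R ns c i p = (\<lambda>j. if j < ns i then c (p(i := j)) else \<zero>\<^bsub>R\<^esub>)"

definition dir_code :: "nat ring \<Rightarrow> (nat \<Rightarrow> nat) \<Rightarrow> nat \<Rightarrow> (nat \<Rightarrow> (nat \<Rightarrow> nat) set) \<Rightarrow> nat
                        \<Rightarrow> ((nat \<Rightarrow> nat) \<Rightarrow> nat) set" where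
  "dir_code R ns t C i = {c \<in> arrays R ns t. \<forall>p\<in>positions ns t. column R ns c i p \<in> C i}"

definition arr_sum :: "nat ring \<Rightarrow> nat \<Rightarrow> (nat \<Rightarrow> (nat \<Rightarrow> nat) \<Rightarrow> nat) \<Rightarrow> (nat \<Rightarrow> nat) \<Rightarrow> nat" where
  "arr_sum R t cs = (\<lambda>p. finsum R (\<lambda>i. cs i p) {..<t})"

definition sum_code :: "nat ring \<Rightarrow> (nat \<Rightarrow> nat) \<Rightarrow> nat \<Rightarrow> (nat \<Rightarrow> (nat \<Rightarrow> nat) set)
                        \<Rightarrow> ((nat \<Rightarrow> nat) \<Rightarrow> nat) set" where
  "sum_code R ns t C = {arr_sum R t cs | cs. \<forall>i<t. cs i \<in> dir_code R ns t C i}"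

definition weight :: "nat ring \<Rightarrow> (nat \<Rightarrow> nat) \<Rightarrow> nat \<Rightarrow> ((nat \<Rightarrow> nat) \<Rightarrow> nat) \<Rightarrow> nat" where
  "weight R ns t c = card {p \<in> positions ns t. c p \<noteq> \<zero>\<^bsub>R\<^esub>}"

text \<open>|c|_i: number of nonzero direction-i columns; each column is represented
  by its unique position with i-th coordinate 0.\<close>
definition col_weight :: "nat ring \<Rightarrow> (nat \<Rightarrow> nat) \<Rightarrow> nat \<Rightarrow> ((nat \<Rightarrow> nat) \<Rightarrow> nat) \<Rightarrow> nat \<Rightarrow> nat" where
  "col_weight R ns t c i = card {p \<in> positions ns t. p i = 0 \<and> column R ns c i p \<noteq> (\<lambda>_. \<zero>\<^bsub>R\<^esub>)}"

text \<open>The product-expansion of (C_i)_{i<t} is at least rho: since the product-expansion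
  is the largest rho with the decomposition property below (and the property is
  monotone in rho), "product-expansion >= rho" means the property holds at rho.\<close>
definition pe_at_least :: "nat ring \<Rightarrow> (nat \<Rightarrow> nat) \<Rightarrow> nat \<Rightarrow> (nat \<Rightarrow> (nat \<Rightarrow> nat) set) \<Rightarrow> real \<Rightarrow> bool" where
  "pe_at_least R ns t C \<rho> \<longleftrightarrow>
     (\<forall>c\<in>sum_code R ns t C. \<exists>cs. (\<forall>i<t. cs i \<in> dir_code R ns t C i) \<and> c = arr_sum R t cs
        \<and> real (weight R ns t c) \<ge> \<rho> * (\<Sum>i<t. real (ns i) * real (col_weight R ns t (cs i) i)))"

end

theory Submission
  imports Defs
begin

text \<open>
  Let \<open>c\<close> lie in the new sum code.  It also lies in the old one, so product-expansion gives
  \<open>c = c\<^sub>1 + \<dots> + c\<^sub>t\<close> with \<open>c\<^sub>i \<in> C\<^sup>(\<^sup>i\<^sup>)\<close> and \<open>|c| \<ge> \<rho> \<Sum> n\<^sub>i |c\<^sub>i|\<^sub>i\<close>; only \<open>c\<^sub>t\<close> may have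
  columns outside the subcode \<open>C'\<close>.  Fix a linear projection \<open>P\<close> of \<open>F\<^sup>n\<close> onto \<open>C'\<close> and split
  \<open>c\<^sub>t = P c\<^sub>t + r\<close> columnwise.  For each coordinate \<open>j\<close>, apply along direction \<open>t\<close> the map
  \<open>v \<mapsto> (v - P v)\<^sub>j e\<^sub>j\<^sub>0\<close>: it kills every array whose direction-\<open>t\<close> columns lie in \<open>C'\<close> and
  preserves every \<open>C\<^sup>(\<^sup>i\<^sup>)\<close> with \<open>i \<noteq> t\<close>.  Applied to two decompositions of \<open>c\<close> (over the new and
  over the old family) it shows that the image of \<open>c\<^sub>t\<close>, the slice of \<open>r\<close> at \<open>j\<close> moved to the
  slice \<open>j\<^sub>0\<close>, lies in the old sum code; its weight is at most \<open>|c\<^sub>t|\<^sub>t\<close>, so product-expansion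
  decomposes it cheaply.  A parity check \<open>\<phi>\<close> of the proper code \<open>C\<^sub>t\<close> with \<open>\<phi> e\<^sub>j\<^sub>0 = 1\<close>,
  applied along direction \<open>t\<close>, reassembles these decompositions into one of \<open>r\<close> without
  direction-\<open>t\<close> part.  The weighted column weights grow by at most a factor \<open>1 + 1/\<rho>\<close>, so
  \<open>\<rho>' = \<rho>\<^sup>2 / (1 + \<rho>)\<close> works, over every field.
\<close>

section \<open>Vectors, linear forms and linear endomorphisms\<close>

locale coeff_cring = cring R for R :: "nat ring" (structure)

locale coeff_field = coeff_cring + field R

definition unit_vec :: "nat ring \<Rightarrow> nat \<Rightarrow> nat \<Rightarrow> nat" where
  "unit_vec R m = (\<lambda>k. if k = m then \<one>\<^bsub>R\<^esub> else \<zero>\<^bsub>R\<^esub>)"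

definition lin_form :: "nat ring \<Rightarrow> nat \<Rightarrow> ((nat \<Rightarrow> nat) \<Rightarrow> nat) \<Rightarrow> bool" where
  "lin_form R n \<phi> \<longleftrightarrow> (\<forall>v\<in>vecs R n. \<phi> v \<in> carrier R)
     \<and> (\<forall>u\<in>vecs R n. \<forall>v\<in>vecs R n. \<phi> (\<lambda>j. u j \<oplus>\<^bsub>R\<^esub> v j) = \<phi> u \<oplus>\<^bsub>R\<^esub> \<phi> v)
     \<and> (\<forall>a\<in>carrier R. \<forall>v\<in>vecs R n. \<phi> (\<lambda>j. a \<otimes>\<^bsub>R\<^esub> v j) = a \<otimes>\<^bsub>R\<^esub> \<phi> v)"

definition lin_endo :: "nat ring \<Rightarrow> nat \<Rightarrow> ((nat \<Rightarrow> nat) \<Rightarrow> nat \<Rightarrow> nat) \<Rightarrow> bool" where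
  "lin_endo R n L \<longleftrightarrow> (\<forall>v\<in>vecs R n. L v \<in> vecs R n) \<and> (\<forall>k. lin_form R n (\<lambda>v. L v k))"

context coeff_cring
begin

lemma vecs_carrier [simp]: "v \<in> vecs R n \<Longrightarrow> v k \<in> carrier R"
  unfolding vecs_def by (cases "k < n") auto

lemma vecs_beyond: "v \<in> vecs R n \<Longrightarrow> n \<le> k \<Longrightarrow> v k = \<zero>"
  unfolding vecs_def by auto

lemma vecsI: "(\<And>k. v k \<in> carrier R) \<Longrightarrow> (\<And>k. n \<le> k \<Longrightarrow> v k = \<zero>) \<Longrightarrow> v \<in> vecs R n"
  unfolding vecs_def by auto

lemma unit_vec_vecs [simp]: "m < n \<Longrightarrow> unit_vec R m \<in> vecs R n"
  unfolding vecs_def unit_vec_def by auto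

lemma unit_vec_carrier [simp]: "unit_vec R m k \<in> carrier R"
  unfolding unit_vec_def by auto

lemma lin_code_vecs: "lin_code R n (vecs R n)"
  unfolding lin_code_def vecs_def by auto

lemma lin_codeD:
  assumes "lin_code R n C"
  shows lin_code_subset: "C \<subseteq> vecs R n"
    and lin_code_zero: "(\<lambda>_. \<zero>) \<in> C"
    and lin_code_add: "u \<in> C \<Longrightarrow> v \<in> C \<Longrightarrow> (\<lambda>j. u j \<oplus> v j) \<in> C"
    and lin_code_smult: "a \<in> carrier R \<Longrightarrow> v \<in> C \<Longrightarrow> (\<lambda>j. a \<otimes> v j) \<in> C"
  using assms unfolding lin_code_def by auto

lemma lin_code_carrier [simp]: "lin_code R n C \<Longrightarrow> v \<in> C \<Longrightarrow> v k \<in> carrier R"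
  by (blast dest: lin_code_subset intro: vecs_carrier)

lemma vecs_add [simp]: "u \<in> vecs R n \<Longrightarrow> v \<in> vecs R n \<Longrightarrow> (\<lambda>j. u j \<oplus> v j) \<in> vecs R n"
  by (rule lin_code_add[OF lin_code_vecs])

lemma vecs_smult [simp]: "a \<in> carrier R \<Longrightarrow> v \<in> vecs R n \<Longrightarrow> (\<lambda>j. a \<otimes> v j) \<in> vecs R n"
  by (rule lin_code_smult[OF lin_code_vecs])

lemma vecs_zero [simp]: "(\<lambda>_. \<zero>) \<in> vecs R n"
  by (rule lin_code_zero[OF lin_code_vecs])

lemma vecs_Suc_lower:
  assumes v: "v \<in> vecs R (Suc k)" and vk: "v k = \<zero>"
  shows "v \<in> vecs R k"
proof (rule vecsI)
  show "v j = \<zero>" if "k \<le> j" for j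
    using that vk vecs_beyond[OF v, of j] by (cases "j = k") auto
qed (use v in simp)

lemma lin_code_finsum:
  assumes C: "lin_code R n C" and "finite A" and "\<And>m. m \<in> A \<Longrightarrow> v m \<in> C"
  shows "(\<lambda>k. \<Oplus>m\<in>A. v m k) \<in> C"
  using assms(2,3)
proof (induction A rule: finite_induct)
  case empty
  show ?case using lin_code_zero[OF C] by simp
next
  case (insert x A)
  then have "(\<lambda>k. \<Oplus>m\<in>insert x A. v m k) = (\<lambda>k. v x k \<oplus> (\<Oplus>m\<in>A. v m k))"
    using C by (auto simp: Pi_def)
  then show ?case using insert lin_code_add[OF C] by simp
qed

lemma lin_code_lincomb:
  assumes C: "lin_code R n C" and "finite A"
    and "\<And>m. m \<in> A \<Longrightarrow> v m \<in> C" and "\<And>m. m \<in> A \<Longrightarrow> a m \<in> carrier R"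
  shows "(\<lambda>k. \<Oplus>m\<in>A. a m \<otimes> v m k) \<in> C"
  using lin_code_finsum[OF C, of A "\<lambda>m k. a m \<otimes> v m k"] assms lin_code_smult[OF C] by simp

lemma vec_expansion:
  assumes v: "v \<in> vecs R n"
  shows "(\<lambda>k. \<Oplus>m\<in>{..<n}. v m \<otimes> unit_vec R m k) = v"
proof
  fix k
  have "(\<Oplus>m\<in>{..<n}. v m \<otimes> unit_vec R m k) = (\<Oplus>m\<in>{..<n}. if k = m then v m else \<zero>)"
    by (rule finsum_cong') (use v in \<open>auto simp: unit_vec_def\<close>)
  also have "\<dots> = v k"
  proof (cases "k < n")
    case False
    then have "(\<Oplus>m\<in>{..<n}. if k = m then v m else \<zero>) = (\<Oplus>m\<in>{..<n}. \<zero>)"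
      by (intro finsum_cong') auto
    then show ?thesis using False vecs_beyond[OF v] by simp
  qed (use v in \<open>auto intro: finsum_singleton\<close>)
  finally show "(\<Oplus>m\<in>{..<n}. v m \<otimes> unit_vec R m k) = v k" .
qed

lemma lin_code_eq_vecs_if_unit_vecs:
  assumes C: "lin_code R n C" and units: "\<And>m. m < n \<Longrightarrow> unit_vec R m \<in> C"
  shows "C = vecs R n"
proof
  show "vecs R n \<subseteq> C"
  proof
    fix v assume v: "v \<in> vecs R n"
    have "(\<lambda>k. \<Oplus>m\<in>{..<n}. v m \<otimes> unit_vec R m k) \<in> C"
      by (rule lin_code_lincomb[OF C]) (use units v in auto)
    then show "v \<in> C" using vec_expansion[OF v] by simp
  qed
qed (rule lin_code_subset[OF C])

lemma lin_formD:
  assumes "lin_form R n \<phi>"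
  shows lin_form_carrier [simp]: "v \<in> vecs R n \<Longrightarrow> \<phi> v \<in> carrier R"
    and lin_form_additive: "u \<in> vecs R n \<Longrightarrow> v \<in> vecs R n \<Longrightarrow> \<phi> (\<lambda>j. u j \<oplus> v j) = \<phi> u \<oplus> \<phi> v"
    and lin_form_homogeneous: "a \<in> carrier R \<Longrightarrow> v \<in> vecs R n \<Longrightarrow> \<phi> (\<lambda>j. a \<otimes> v j) = a \<otimes> \<phi> v"
  using assms unfolding lin_form_def by auto

lemma lin_form_zero: "lin_form R n \<phi> \<Longrightarrow> \<phi> (\<lambda>_. \<zero>) = \<zero>"
  using lin_form_homogeneous[of n \<phi> \<zero> "\<lambda>_. \<zero>"] by simp

lemma lin_form_finsum:
  assumes \<phi>: "lin_form R n \<phi>" and "finite A" and "\<And>m. m \<in> A \<Longrightarrow> w m \<in> vecs R n"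
  shows "\<phi> (\<lambda>k. \<Oplus>m\<in>A. w m k) = (\<Oplus>m\<in>A. \<phi> (w m))"
  using assms(2,3)
proof (induction A rule: finite_induct)
  case empty
  show ?case using lin_form_zero[OF \<phi>] by simp
next
  case (insert x A)
  have "\<And>m k. m \<in> insert x A \<Longrightarrow> w m k \<in> carrier R"
    using insert.prems by (blast intro: vecs_carrier)
  then have "(\<lambda>k. \<Oplus>m\<in>insert x A. w m k) = (\<lambda>k. w x k \<oplus> (\<Oplus>m\<in>A. w m k))"
    using insert by (simp add: Pi_def)
  moreover have "(\<lambda>k. \<Oplus>m\<in>A. w m k) \<in> vecs R n"
    using lin_code_finsum[OF lin_code_vecs] insert by auto
  moreover have "(\<lambda>m. \<phi> (w m)) \<in> A \<rightarrow> carrier R"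
    using insert.prems \<phi> by auto
  ultimately show ?case
    using insert lin_form_additive[OF \<phi>] \<phi> by simp
qed

lemma lin_form_lincomb:
  assumes \<phi>: "lin_form R n \<phi>" and "finite A"
    and "\<And>m. m \<in> A \<Longrightarrow> w m \<in> vecs R n" and "\<And>m. m \<in> A \<Longrightarrow> a m \<in> carrier R"
  shows "\<phi> (\<lambda>k. \<Oplus>m\<in>A. a m \<otimes> w m k) = (\<Oplus>m\<in>A. a m \<otimes> \<phi> (w m))"
proof -
  have "\<phi> (\<lambda>k. \<Oplus>m\<in>A. a m \<otimes> w m k) = (\<Oplus>m\<in>A. \<phi> (\<lambda>k. a m \<otimes> w m k))"
    using lin_form_finsum[OF \<phi>, of A "\<lambda>m k. a m \<otimes> w m k"] assms by simp
  also have "\<dots> = (\<Oplus>m\<in>A. a m \<otimes> \<phi> (w m))"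
    by (rule finsum_cong') (use assms lin_form_homogeneous[OF \<phi>] in auto)
  finally show ?thesis .
qed

lemma lin_form_expansion:
  assumes "lin_form R n \<phi>" and "v \<in> vecs R n"
  shows "\<phi> v = (\<Oplus>m\<in>{..<n}. v m \<otimes> \<phi> (unit_vec R m))"
  using lin_form_lincomb[OF assms(1), of "{..<n}" "unit_vec R" v] vec_expansion[OF assms(2)] assms(2)
  by simp

lemma lin_form_coord: "lin_form R n (\<lambda>v. v k)"
  unfolding lin_form_def by simp

lemma lin_form_add:
  assumes \<phi>: "lin_form R n \<phi>" and \<psi>: "lin_form R n \<psi>"
  shows "lin_form R n (\<lambda>v. \<phi> v \<oplus> \<psi> v)"
  unfolding lin_form_def
  using lin_formD[OF \<phi>] lin_formD[OF \<psi>] by (auto simp: a_ac r_distr)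

lemma lin_form_diff:
  assumes \<phi>: "lin_form R n \<phi>" and \<psi>: "lin_form R n \<psi>"
  shows "lin_form R n (\<lambda>v. \<phi> v \<ominus> \<psi> v)"
  unfolding lin_form_def
  using lin_formD[OF \<phi>] lin_formD[OF \<psi>] by (auto simp: minus_add r_minus a_ac r_distr minus_eq)

lemma lin_form_scale:
  assumes \<phi>: "lin_form R n \<phi>" and c: "c \<in> carrier R"
  shows "lin_form R n (\<lambda>v. \<phi> v \<otimes> c)"
  unfolding lin_form_def
  using lin_formD[OF \<phi>] c by (auto simp: l_distr m_assoc)

lemma lin_endoD:
  assumes "lin_endo R n L"
  shows lin_endo_vecs [simp]: "v \<in> vecs R n \<Longrightarrow> L v \<in> vecs R n"
    and lin_endo_coord: "lin_form R n (\<lambda>v. L v k)"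
  using assms unfolding lin_endo_def by auto

lemma lin_endo_carrier [simp]: "lin_endo R n L \<Longrightarrow> v \<in> vecs R n \<Longrightarrow> L v k \<in> carrier R"
  using lin_endo_vecs vecs_carrier by blast

lemma lin_endo_additive:
  "lin_endo R n L \<Longrightarrow> u \<in> vecs R n \<Longrightarrow> v \<in> vecs R n \<Longrightarrow> L (\<lambda>j. u j \<oplus> v j) = (\<lambda>j. L u j \<oplus> L v j)"
  using lin_form_additive[OF lin_endo_coord] by blast

lemma lin_endo_homogeneous:
  "lin_endo R n L \<Longrightarrow> a \<in> carrier R \<Longrightarrow> v \<in> vecs R n \<Longrightarrow> L (\<lambda>j. a \<otimes> v j) = (\<lambda>j. a \<otimes> L v j)"
  using lin_form_homogeneous[OF lin_endo_coord] by blast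

lemma lin_endo_zero: "lin_endo R n L \<Longrightarrow> L (\<lambda>_. \<zero>) = (\<lambda>_. \<zero>)"
  using lin_form_zero[OF lin_endo_coord] by blast

lemma lin_endo_id: "lin_endo R n (\<lambda>v. v)"
  unfolding lin_endo_def using lin_form_coord by blast

lemma lin_endo_add:
  "lin_endo R n L \<Longrightarrow> lin_endo R n M \<Longrightarrow> lin_endo R n (\<lambda>v j. L v j \<oplus> M v j)"
  unfolding lin_endo_def using lin_form_add by simp

lemma lin_form_comp:
  assumes \<phi>: "lin_form R n \<phi>" and M: "lin_endo R n M"
  shows "lin_form R n (\<lambda>v. \<phi> (M v))"
  unfolding lin_form_def
  using lin_formD[OF \<phi>] lin_endo_additive[OF M] lin_endo_homogeneous[OF M] M by simp

lemma lin_endo_comp: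
  assumes L: "lin_endo R n L" and M: "lin_endo R n M"
  shows "lin_endo R n (\<lambda>v. L (M v))"
  unfolding lin_endo_def using lin_form_comp[OF lin_endo_coord[OF L] M] L M by simp

lemma lin_endo_outer:
  assumes \<psi>: "lin_form R n \<psi>" and w: "w \<in> vecs R n"
  shows "lin_endo R n (\<lambda>v j. \<psi> v \<otimes> w j)"
  unfolding lin_endo_def using lin_form_scale[OF \<psi>] lin_form_carrier[OF \<psi>] w by auto

end

section \<open>Projections onto codes and parity checks\<close>

definition partial_projection :: "nat ring \<Rightarrow> nat \<Rightarrow> (nat \<Rightarrow> nat) set \<Rightarrow> nat \<Rightarrow> ((nat \<Rightarrow> nat) \<Rightarrow> nat \<Rightarrow> nat) \<Rightarrow> bool" where
  "partial_projection R n U k P \<longleftrightarrow> lin_endo R n P \<and> (\<forall>v\<in>vecs R n. P v \<in> U) \<and> (\<forall>u\<in>U \<inter> vecs R k. P u = u)"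

context coeff_cring
begin

lemma partial_projection_0:
  assumes U: "lin_code R n U"
  shows "\<exists>P. partial_projection R n U 0 P"
proof -
  have "lin_endo R n (\<lambda>_ _. \<zero>)"
    unfolding lin_endo_def lin_form_def by simp
  moreover have "(\<lambda>_. \<zero>) = u" if "u \<in> vecs R 0" for u
    using vecs_beyond[OF that] by (intro ext) simp
  ultimately show ?thesis
    using lin_code_zero[OF U] unfolding partial_projection_def by blast
qed

lemma partial_projection_pivot:
  assumes U: "lin_code R n U" and P: "partial_projection R n U k P"
    and w: "w \<in> U" "w \<in> vecs R (Suc k)" "w k = \<one>"
  shows "\<exists>P'. partial_projection R n U (Suc k) P'"
proof -
  text \<open>Clear coordinate \<open>k\<close> with \<open>w\<close>, project the rest with \<open>P\<close>, and put the \<open>w\<close>-part back.\<close>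
  define r where "r = (\<lambda>v i. v i \<oplus> (v k \<otimes> \<ominus> \<one>) \<otimes> w i)"
  define P' where "P' = (\<lambda>v j. P (r v) j \<oplus> v k \<otimes> w j)"
  have P_lin: "lin_endo R n P" and P_range: "\<And>v. v \<in> vecs R n \<Longrightarrow> P v \<in> U"
    and P_fix: "\<And>u. u \<in> U \<Longrightarrow> u \<in> vecs R k \<Longrightarrow> P u = u"
    using P unfolding partial_projection_def by auto
  have wv: "w \<in> vecs R n" using w(1) lin_code_subset[OF U] by blast
  have wc: "\<And>j. w j \<in> carrier R" using wv by simp
  have r: "lin_endo R n r"
    unfolding r_def by (intro lin_endo_add lin_endo_id lin_endo_outer lin_form_scale lin_form_coord wv) simp
  have "lin_endo R n P'"
    unfolding P'_def by (intro lin_endo_add lin_endo_comp[OF P_lin r] lin_endo_outer lin_form_coord wv)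
  moreover have "P' v \<in> U" if "v \<in> vecs R n" for v
    unfolding P'_def
    using that P_range lin_endo_vecs[OF r] lin_code_add[OF U] lin_code_smult[OF U _ w(1)] by simp
  moreover have "P' u = u" if u: "u \<in> U" "u \<in> vecs R (Suc k)" for u
  proof -
    have uc: "\<And>j. u j \<in> carrier R" using u(1) U by simp
    have "r u \<in> U"
      unfolding r_def using lin_code_add[OF U u(1) lin_code_smult[OF U _ w(1)]] uc by simp
    moreover have "r u \<in> vecs R k"
    proof (rule vecs_Suc_lower)
      show "r u \<in> vecs R (Suc k)" unfolding r_def using u(2) w(2) uc by simp
      show "r u k = \<zero>" unfolding r_def using uc w(3) by (simp add: r_neg r_minus)
    qed
    ultimately have "P (r u) = r u" using P_fix by blast
    then show ?thesis
      unfolding P'_def r_def using uc wc by (intro ext) (simp add: a_assoc l_minus r_minus l_neg)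
  qed
  ultimately show ?thesis unfolding partial_projection_def by blast
qed

lemma partial_projection_skip:
  assumes P: "partial_projection R n U k P" and skip: "\<not> (\<exists>w\<in>U \<inter> vecs R (Suc k). w k \<noteq> \<zero>)"
  shows "\<exists>P'. partial_projection R n U (Suc k) P'"
proof -
  define tr where "tr v = (\<lambda>j. if j = k then \<zero> else v j)" for v :: "nat \<Rightarrow> nat"
  have P_lin: "lin_endo R n P" and P_range: "\<And>v. v \<in> vecs R n \<Longrightarrow> P v \<in> U"
    and P_fix: "\<And>u. u \<in> U \<Longrightarrow> u \<in> vecs R k \<Longrightarrow> P u = u"
    using P unfolding partial_projection_def by auto
  have tr_vecs: "tr v \<in> vecs R n" if "v \<in> vecs R n" for v
    using that unfolding tr_def by (intro vecsI) (simp_all add: vecs_beyond)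
  then have "lin_endo R n tr"
    unfolding lin_endo_def lin_form_def by (simp add: tr_def)
  then have "lin_endo R n (\<lambda>v. P (tr v))" by (rule lin_endo_comp[OF P_lin])
  moreover have "P (tr v) \<in> U" if "v \<in> vecs R n" for v
    using that P_range tr_vecs by blast
  moreover have "P (tr u) = u" if u: "u \<in> U" "u \<in> vecs R (Suc k)" for u
  proof -
    have "u k = \<zero>" using skip u by blast
    then have "tr u = u" unfolding tr_def by auto
    moreover have "u \<in> vecs R k" using vecs_Suc_lower[OF u(2) \<open>u k = \<zero>\<close>] .
    ultimately show ?thesis using P_fix u by simp
  qed
  ultimately show ?thesis unfolding partial_projection_def by blast
qed

end

context coeff_field
begin

lemma lin_code_projection:
  assumes U: "lin_code R n U"
  obtains P where "lin_endo R n P" "\<And>v. v \<in> vecs R n \<Longrightarrow> P v \<in> U" "\<And>u. u \<in> U \<Longrightarrow> P u = u"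
proof -
  have "\<exists>P. partial_projection R n U k P" for k
  proof (induction k)
    case 0
    show ?case by (rule partial_projection_0[OF U])
  next
    case (Suc k)
    then obtain P where P: "partial_projection R n U k P" by blast
    show ?case
    proof (cases "\<exists>w\<in>U \<inter> vecs R (Suc k). w k \<noteq> \<zero>")
      case True
      then obtain w where w: "w \<in> U" "w \<in> vecs R (Suc k)" "w k \<noteq> \<zero>" by blast
      have inv: "inv (w k) \<in> carrier R" "inv (w k) \<otimes> w k = \<one>"
        using w field_Units by auto
      have "(\<lambda>j. inv (w k) \<otimes> w j) \<in> vecs R (Suc k)"
        using inv(1) w(2) by (intro vecsI) (simp_all add: vecs_beyond)
      then show ?thesis
        using partial_projection_pivot[OF U P] lin_code_smult[OF U inv(1) w(1)] inv(2) by blast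
    next
      case False
      then show ?thesis by (rule partial_projection_skip[OF P])
    qed
  qed
  then show ?thesis
    using that lin_code_subset[OF U] unfolding partial_projection_def by blast
qed

lemma proper_code_parity_check:
  assumes C: "lin_code R n C" and proper: "C \<noteq> vecs R n"
  obtains j0 \<phi> where "j0 < n" "lin_form R n \<phi>" "\<phi> (unit_vec R j0) = \<one>" "\<And>v. v \<in> C \<Longrightarrow> \<phi> v = \<zero>"
proof -
  obtain j0 where j0: "j0 < n" "unit_vec R j0 \<notin> C"
    using lin_code_eq_vecs_if_unit_vecs[OF C] proper by blast
  obtain Q where Q: "lin_endo R n Q" "\<And>v. v \<in> vecs R n \<Longrightarrow> Q v \<in> C" "\<And>u. u \<in> C \<Longrightarrow> Q u = u"
    using lin_code_projection[OF C] by blast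
  define e where "e = unit_vec R j0"
  have "e \<noteq> Q e" using Q(2)[of e] j0 unfolding e_def by auto
  then obtain k where "e k \<noteq> Q e k" by blast
  then have dk: "e k \<ominus> Q e k \<in> carrier R - {\<zero>}"
    using Q(1) j0(1) unfolding e_def by simp
  define \<phi> where "\<phi> v = (v k \<ominus> Q v k) \<otimes> inv (e k \<ominus> Q e k)" for v
  show ?thesis
  proof
    show "lin_form R n \<phi>" unfolding \<phi>_def
      using dk field_Units by (intro lin_form_scale lin_form_diff lin_form_coord lin_endo_coord[OF Q(1)]) auto
    show "\<phi> (unit_vec R j0) = \<one>"
      unfolding \<phi>_def e_def[symmetric] using dk field_Units by auto
    show "\<phi> v = \<zero>" if "v \<in> C" for v
      unfolding \<phi>_def using that Q(3) C dk field_Units by (auto simp: r_neg minus_eq)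
  qed (rule j0(1))
qed

end

section \<open>Linear maps applied along one direction of an array\<close>

definition map_columns :: "nat ring \<Rightarrow> (nat \<Rightarrow> nat) \<Rightarrow> nat \<Rightarrow> nat \<Rightarrow> ((nat \<Rightarrow> nat) \<Rightarrow> nat \<Rightarrow> nat)
    \<Rightarrow> ((nat \<Rightarrow> nat) \<Rightarrow> nat) \<Rightarrow> (nat \<Rightarrow> nat) \<Rightarrow> nat" where
  "map_columns R ns t T L x =
     (\<lambda>p. if p \<in> positions ns t then L (column R ns x T p) (p T) else \<zero>\<^bsub>R\<^esub>)"

locale coeff_arrays = coeff_cring +
  fixes ns :: "nat \<Rightarrow> nat" and t :: nat
begin

abbreviation "Pos \<equiv> positions ns t"
abbreviation "Arr \<equiv> arrays R ns t"
abbreviation "col x i p \<equiv> column R ns x i p"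

lemma finite_positions [simp]: "finite Pos"
  unfolding positions_def by (rule finite_PiE) auto

lemma positions_upd [simp]: "p \<in> Pos \<Longrightarrow> i < t \<Longrightarrow> k < ns i \<Longrightarrow> p(i := k) \<in> Pos"
  unfolding positions_def by (auto simp: PiE_iff extensional_def)

lemma positions_coord [simp]: "p \<in> Pos \<Longrightarrow> i < t \<Longrightarrow> p i < ns i"
  unfolding positions_def by (auto simp: PiE_iff)

lemma arrays_carrier [simp]: "x \<in> Arr \<Longrightarrow> x p \<in> carrier R"
  unfolding arrays_def by (cases "p \<in> Pos") auto

lemma arrays_outside: "x \<in> Arr \<Longrightarrow> p \<notin> Pos \<Longrightarrow> x p = \<zero>"
  unfolding arrays_def by auto

lemma arraysI:
  "(\<And>p. x p \<in> carrier R) \<Longrightarrow> (\<And>p. p \<notin> Pos \<Longrightarrow> x p = \<zero>) \<Longrightarrow> x \<in> Arr"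
  unfolding arrays_def by auto

lemma arrays_finsum:
  assumes "finite I" and x: "\<And>i. i \<in> I \<Longrightarrow> x i \<in> Arr"
  shows "(\<lambda>p. \<Oplus>i\<in>I. x i p) \<in> Arr"
proof (rule arraysI)
  have "\<And>i p. i \<in> I \<Longrightarrow> x i p \<in> carrier R" using x arrays_carrier by blast
  then show "(\<Oplus>i\<in>I. x i p) \<in> carrier R" for p by (simp add: Pi_def)
  show "(\<Oplus>i\<in>I. x i p) = \<zero>" if "p \<notin> Pos" for p
    using that x arrays_outside by (intro add.finprod_one_eqI) simp
qed

lemma column_vecs [simp]: "x \<in> Arr \<Longrightarrow> col x i p \<in> vecs R (ns i)"
  unfolding column_def vecs_def by auto

lemma column_upd [simp]: "col x i (p(i := k)) = col x i p"
  by (simp only: column_def fun_upd_upd)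

lemma column_apply [simp]: "k < ns i \<Longrightarrow> col x i p k = x (p(i := k))"
  unfolding column_def by simp

lemma column_beyond: "\<not> k < ns i \<Longrightarrow> col x i p k = \<zero>"
  unfolding column_def by simp

lemma column_finsum:
  "col (\<lambda>p. \<Oplus>j\<in>J. x j p) i p = (\<lambda>k. \<Oplus>j\<in>J. col (x j) i p k)"
  by (rule ext) (simp add: column_def)

lemma column_add: "col (\<lambda>p. x p \<oplus> y p) i p = (\<lambda>k. col x i p k \<oplus> col y i p k)"
  by (rule ext) (simp add: column_def)

lemma dir_codeD:
  assumes "x \<in> dir_code R ns t C i"
  shows dir_code_arrays: "x \<in> Arr"
    and dir_code_column: "p \<in> Pos \<Longrightarrow> col x i p \<in> C i"
  using assms unfolding dir_code_def by auto

lemma dir_codeI: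
  "x \<in> Arr \<Longrightarrow> (\<And>p. p \<in> Pos \<Longrightarrow> col x i p \<in> C i)
   \<Longrightarrow> x \<in> dir_code R ns t C i"
  unfolding dir_code_def by auto

lemma arrays_add [simp]: "x \<in> Arr \<Longrightarrow> y \<in> Arr \<Longrightarrow> (\<lambda>p. x p \<oplus> y p) \<in> Arr"
  by (intro arraysI) (auto simp: arrays_outside)

lemma arrays_smult [simp]: "a \<in> carrier R \<Longrightarrow> x \<in> Arr \<Longrightarrow> (\<lambda>p. a \<otimes> x p) \<in> Arr"
  by (intro arraysI) (simp_all add: arrays_outside)

lemma arrays_zero [simp]: "(\<lambda>_. \<zero>) \<in> Arr"
  by (intro arraysI) auto

context
  fixes C :: "nat \<Rightarrow> (nat \<Rightarrow> nat) set" and i :: nat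
  assumes C: "lin_code R (ns i) (C i)"
begin

lemma dir_code_zero: "(\<lambda>_. \<zero>) \<in> dir_code R ns t C i"
  using lin_code_zero[OF C] by (intro dir_codeI) (auto simp: column_def)

lemma dir_code_add:
  assumes x: "x \<in> dir_code R ns t C i" and y: "y \<in> dir_code R ns t C i"
  shows "(\<lambda>p. x p \<oplus> y p) \<in> dir_code R ns t C i"
proof (rule dir_codeI)
  fix p assume "p \<in> Pos"
  show "col (\<lambda>p. x p \<oplus> y p) i p \<in> C i"
    unfolding column_add using lin_code_add[OF C] dir_code_column[OF x \<open>p \<in> Pos\<close>] dir_code_column[OF y \<open>p \<in> Pos\<close>] by simp
qed (use dir_code_arrays[OF x] dir_code_arrays[OF y] in simp)

lemma dir_code_smult:
  assumes a: "a \<in> carrier R" and x: "x \<in> dir_code R ns t C i"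
  shows "(\<lambda>p. a \<otimes> x p) \<in> dir_code R ns t C i"
proof (rule dir_codeI)
  fix p assume "p \<in> Pos"
  have "col (\<lambda>p. a \<otimes> x p) i p = (\<lambda>k. a \<otimes> col x i p k)"
    using a by (intro ext) (simp add: column_def)
  then show "col (\<lambda>p. a \<otimes> x p) i p \<in> C i"
    using lin_code_smult[OF C a] dir_code_column[OF x \<open>p \<in> Pos\<close>] by simp
qed (use a dir_code_arrays[OF x] in simp)

lemma dir_code_diff:
  assumes x: "x \<in> dir_code R ns t C i" and y: "y \<in> dir_code R ns t C i"
  shows "(\<lambda>p. x p \<ominus> y p) \<in> dir_code R ns t C i"
proof -
  have "(\<lambda>p. x p \<ominus> y p) = (\<lambda>p. x p \<oplus> \<ominus> \<one> \<otimes> y p)"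
    using dir_code_arrays[OF y] by (intro ext) (simp add: a_minus_def l_minus)
  then show ?thesis using dir_code_add[OF x dir_code_smult[OF _ y]] by simp
qed

lemma dir_code_finsum:
  assumes "finite J" and "\<And>j. j \<in> J \<Longrightarrow> x j \<in> dir_code R ns t C i"
  shows "(\<lambda>p. \<Oplus>j\<in>J. x j p) \<in> dir_code R ns t C i"
  using assms
proof (induction J rule: finite_induct)
  case empty
  then show ?case using dir_code_zero by simp
next
  case (insert j J)
  have "\<And>j' p. j' \<in> insert j J \<Longrightarrow> x j' p \<in> carrier R"
    using insert.prems by (meson arrays_carrier dir_code_arrays)
  then have "(\<lambda>p. \<Oplus>j'\<in>insert j J. x j' p) = (\<lambda>p. x j p \<oplus> (\<Oplus>j'\<in>J. x j' p))"
    using insert.hyps by (simp add: Pi_def)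
  moreover have "(\<lambda>p. \<Oplus>j'\<in>J. x j' p) \<in> dir_code R ns t C i" using insert by blast
  ultimately show ?case using dir_code_add[of "x j"] insert.prems by simp
qed

end

lemma col_weight_add_le: "col_weight R ns t (\<lambda>p. x p \<oplus> y p) i \<le> col_weight R ns t x i + col_weight R ns t y i"
proof -
  have "{p \<in> Pos. p i = 0 \<and> col (\<lambda>p. x p \<oplus> y p) i p \<noteq> (\<lambda>_. \<zero>)}
      \<subseteq> {p \<in> Pos. p i = 0 \<and> col x i p \<noteq> (\<lambda>_. \<zero>)} \<union> {p \<in> Pos. p i = 0 \<and> col y i p \<noteq> (\<lambda>_. \<zero>)}"
    (is "?S \<subseteq> ?X \<union> ?Y") by (auto simp: column_add)
  then have "card ?S \<le> card (?X \<union> ?Y)" by (intro card_mono) auto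
  then show ?thesis
    unfolding col_weight_def using card_Un_le[of ?X ?Y] by linarith
qed

lemma col_weight_finsum_le:
  assumes "finite J"
  shows "col_weight R ns t (\<lambda>p. \<Oplus>j\<in>J. x j p) i \<le> (\<Sum>j\<in>J. col_weight R ns t (x j) i)"
proof -
  have "{p \<in> Pos. p i = 0 \<and> col (\<lambda>p. \<Oplus>j\<in>J. x j p) i p \<noteq> (\<lambda>_. \<zero>)}
      \<subseteq> (\<Union>j\<in>J. {p \<in> Pos. p i = 0 \<and> col (x j) i p \<noteq> (\<lambda>_. \<zero>)})"
    (is "?S \<subseteq> (\<Union>j\<in>J. ?X j)")
  proof
    fix p assume "p \<in> ?S"
    moreover have "col (\<lambda>p. \<Oplus>j\<in>J. x j p) i p = (\<lambda>_. \<zero>)" if "\<forall>j\<in>J. col (x j) i p = (\<lambda>_. \<zero>)"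
      unfolding column_finsum using that by (intro ext add.finprod_one_eqI) (simp add: fun_eq_iff)
    ultimately show "p \<in> (\<Union>j\<in>J. ?X j)" by blast
  qed
  then have "card ?S \<le> card (\<Union>j\<in>J. ?X j)" using assms by (intro card_mono) auto
  then show ?thesis
    unfolding col_weight_def using card_UN_le[OF assms, of ?X] by linarith
qed

context
  fixes T :: nat
  assumes T: "T < t"
begin

lemma map_columns_apply: "p \<in> Pos \<Longrightarrow> map_columns R ns t T L x p = L (col x T p) (p T)"
  by (simp add: map_columns_def)

lemma map_columns_outside: "p \<notin> Pos \<Longrightarrow> map_columns R ns t T L x p = \<zero>"
  by (simp add: map_columns_def)

context
  fixes L :: "(nat \<Rightarrow> nat) \<Rightarrow> nat \<Rightarrow> nat"
  assumes L: "lin_endo R (ns T) L"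
begin

lemma map_columns_arrays [simp]: "x \<in> Arr \<Longrightarrow> map_columns R ns t T L x \<in> Arr"
  using L by (intro arraysI) (simp_all add: map_columns_def)

lemma column_map_columns:
  assumes x: "x \<in> Arr" and p: "p \<in> Pos"
  shows "col (map_columns R ns t T L x) T p = L (col x T p)"
proof
  fix k
  show "col (map_columns R ns t T L x) T p k = L (col x T p) k"
  proof (cases "k < ns T")
    case True
    then show ?thesis using p T by (simp add: map_columns_apply)
  next
    case False
    then show ?thesis
      using vecs_beyond[OF lin_endo_vecs[OF L column_vecs[OF x]]] by (simp add: column_beyond)
  qed
qed

lemma map_columns_finsum:
  assumes "finite I" and x: "\<And>i. i \<in> I \<Longrightarrow> x i \<in> Arr"
  shows "map_columns R ns t T L (\<lambda>p. \<Oplus>i\<in>I. x i p) = (\<lambda>p. \<Oplus>i\<in>I. map_columns R ns t T L (x i) p)"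
proof
  fix p
  show "map_columns R ns t T L (\<lambda>p. \<Oplus>i\<in>I. x i p) p = (\<Oplus>i\<in>I. map_columns R ns t T L (x i) p)"
  proof (cases "p \<in> Pos")
    case True
    then show ?thesis
      unfolding map_columns_apply[OF True] column_finsum
      using lin_form_finsum[OF lin_endo_coord[OF L], of I "\<lambda>i. col (x i) T p"] assms by simp
  qed (simp add: map_columns_outside)
qed

lemma map_columns_dir_code:
  assumes i: "i < t" "i \<noteq> T" and C: "lin_code R (ns i) (C i)" and x: "x \<in> dir_code R ns t C i"
  shows "map_columns R ns t T L x \<in> dir_code R ns t C i"
proof (rule dir_codeI)
  have xa: "x \<in> Arr" using x by (rule dir_code_arrays)
  then show "map_columns R ns t T L x \<in> Arr" by simp
  fix p assume p: "p \<in> Pos"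
  text \<open>The direction-\<open>i\<close> column at \<open>p\<close> is a combination of the direction-\<open>i\<close> columns at the \<open>p(T := m)\<close>,
    with coefficients taken from the matrix of \<open>L\<close>.\<close>
  have "col (map_columns R ns t T L x) i p
      = (\<lambda>k. \<Oplus>m\<in>{..<ns T}. L (unit_vec R m) (p T) \<otimes> col x i (p(T := m)) k)"
  proof
    fix k
    show "col (map_columns R ns t T L x) i p k = (\<Oplus>m\<in>{..<ns T}. L (unit_vec R m) (p T) \<otimes> col x i (p(T := m)) k)"
    proof (cases "k < ns i")
      case True
      have "col (map_columns R ns t T L x) i p k = L (col x T (p(i := k))) (p T)"
        using True p i by (simp add: map_columns_apply)
      also have "\<dots> = (\<Oplus>m\<in>{..<ns T}. col x T (p(i := k)) m \<otimes> L (unit_vec R m) (p T))"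
        using lin_form_expansion[OF lin_endo_coord[OF L]] xa by simp
      also have "\<dots> = (\<Oplus>m\<in>{..<ns T}. L (unit_vec R m) (p T) \<otimes> col x i (p(T := m)) k)"
        using True i xa L by (intro finsum_cong') (auto simp: fun_upd_twist m_comm)
      finally show ?thesis .
    next
      case False
      have "\<And>m. m < ns T \<Longrightarrow> L (unit_vec R m) (p T) \<in> carrier R"
        using lin_endo_carrier[OF L] by simp
      then show ?thesis
        using False by (simp add: column_beyond) (rule add.finprod_one_eqI[THEN sym], simp)
    qed
  qed
  also have "\<dots> \<in> C i"
    using p T x L by (intro lin_code_lincomb[OF C]) (auto simp: dir_code_column)
  finally show "col (map_columns R ns t T L x) i p \<in> C i" .
qed

lemma map_columns_vanish:
  assumes x: "x \<in> dir_code R ns t C T" and ker: "\<And>v. v \<in> C T \<Longrightarrow> L v = (\<lambda>_. \<zero>)"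
  shows "map_columns R ns t T L x = (\<lambda>_. \<zero>)"
  using dir_code_column[OF x] ker by (auto simp: map_columns_def)

lemma map_columns_dir_code_range:
  assumes x: "x \<in> Arr" and range: "\<And>v. v \<in> vecs R (ns T) \<Longrightarrow> L v \<in> C T"
  shows "map_columns R ns t T L x \<in> dir_code R ns t C T"
  using x range by (intro dir_codeI) (simp_all add: column_map_columns)

lemma col_weight_map_columns_le:
  assumes x: "x \<in> Arr"
  shows "col_weight R ns t (map_columns R ns t T L x) T \<le> col_weight R ns t x T"
  unfolding col_weight_def
  using x lin_endo_zero[OF L] by (intro card_mono) (auto simp: column_map_columns)

context
  fixes j :: nat
  assumes slice: "\<And>v k. v \<in> vecs R (ns T) \<Longrightarrow> k \<noteq> j \<Longrightarrow> L v k = \<zero>"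
begin

lemma map_columns_slice_nonzero:
  assumes x: "x \<in> Arr" and p: "p \<in> Pos" and nz: "map_columns R ns t T L x p \<noteq> \<zero>"
  shows "p T = j" and "col x T p \<noteq> (\<lambda>_. \<zero>)"
  using nz slice[OF column_vecs[OF x]] lin_endo_zero[OF L] by (auto simp: map_columns_apply[OF p])

lemma weight_map_columns_slice_le:
  assumes x: "x \<in> Arr"
  shows "weight R ns t (map_columns R ns t T L x) \<le> col_weight R ns t x T"
proof -
  define Z where "Z = {p \<in> Pos. map_columns R ns t T L x p \<noteq> \<zero>}"
  have "inj_on (\<lambda>p. p(T := 0)) Z"
  proof (rule inj_onI)
    fix p q assume "p \<in> Z" "q \<in> Z" "p(T := 0) = q(T := 0)"
    then have "(p(T := 0))(T := j) = (q(T := 0))(T := j)" "p T = j" "q T = j"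
      using map_columns_slice_nonzero[OF x] unfolding Z_def by auto
    then show "p = q" by (metis fun_upd_triv fun_upd_upd)
  qed
  moreover have "(\<lambda>p. p(T := 0)) ` Z \<subseteq> {p \<in> Pos. p T = 0 \<and> col x T p \<noteq> (\<lambda>_. \<zero>)}"
  proof (rule image_subsetI)
    fix p assume "p \<in> Z"
    then have p: "p \<in> Pos" and "col x T p \<noteq> (\<lambda>_. \<zero>)"
      using map_columns_slice_nonzero[OF x] unfolding Z_def by auto
    moreover have "p(T := 0) \<in> Pos"
      using positions_coord[OF p T] by (intro positions_upd[OF p T]) simp
    ultimately show "p(T := 0) \<in> {p \<in> Pos. p T = 0 \<and> col x T p \<noteq> (\<lambda>_. \<zero>)}" by simp
  qed
  ultimately show ?thesis
    unfolding weight_def col_weight_def Z_def by (intro card_inj_on_le) auto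
qed

lemma col_weight_map_columns_slice_le:
  assumes x: "x \<in> Arr" and i: "i < t" "i \<noteq> T"
  shows "col_weight R ns t (map_columns R ns t T L x) i \<le> col_weight R ns t x i"
proof -
  define S where "S = {p \<in> Pos. p i = 0 \<and> col (map_columns R ns t T L x) i p \<noteq> (\<lambda>_. \<zero>)}"
  have S: "p T = j \<and> (\<exists>m<ns T. col x i (p(T := m)) \<noteq> (\<lambda>_. \<zero>))" if pS: "p \<in> S" for p
  proof -
    obtain k where k: "col (map_columns R ns t T L x) i p k \<noteq> \<zero>" and p: "p \<in> Pos"
      using pS unfolding S_def by (auto simp: fun_eq_iff)
    then have "k < ns i" by (metis column_beyond)
    then have pk: "p(i := k) \<in> Pos" and nz: "map_columns R ns t T L x (p(i := k)) \<noteq> \<zero>"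
      using k p i by auto
    obtain m where "m < ns T" "x (p(i := k, T := m)) \<noteq> \<zero>"
      using map_columns_slice_nonzero(2)[OF x pk nz] by (metis column_apply column_beyond fun_eq_iff)
    then have "m < ns T \<and> col x i (p(T := m)) k \<noteq> \<zero>"
      using \<open>k < ns i\<close> i by (simp add: fun_upd_twist)
    then show ?thesis using map_columns_slice_nonzero(1)[OF x pk nz] i by auto
  qed
  define g where "g p = p(T := SOME m. m < ns T \<and> col x i (p(T := m)) \<noteq> (\<lambda>_. \<zero>))" for p
  have g: "g p \<in> Pos \<and> g p i = 0 \<and> col x i (g p) \<noteq> (\<lambda>_. \<zero>)" if "p \<in> S" for p
    using someI_ex[OF conjunct2[OF S[OF that]]] that T i unfolding g_def S_def by auto
  have "inj_on g S"
  proof (rule inj_onI)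
    fix p q assume "p \<in> S" "q \<in> S" "g p = g q"
    then have "(g p)(T := j) = (g q)(T := j)" "p T = j" "q T = j" using S by auto
    then show "p = q" unfolding g_def by (metis fun_upd_triv fun_upd_upd)
  qed
  with g show ?thesis
    unfolding col_weight_def S_def[symmetric] by (intro card_inj_on_le) auto
qed

end

end

end

end

section \<open>Replacing one code by a subcode\<close>

lemma subcode_expansion_arith:
  fixes \<rho> S Y Z w :: real
  assumes "\<rho> > 0" "\<rho> * S \<le> w" "\<rho> * Y \<le> S" "Z \<le> S + Y"
  shows "\<rho> * \<rho> / (1 + \<rho>) * Z \<le> w"
proof -
  have "\<rho> * \<rho> * Z \<le> \<rho> * \<rho> * (S + Y)"
    using assms by (intro mult_left_mono) auto
  also have "\<dots> = \<rho> * (\<rho> * S) + \<rho> * (\<rho> * Y)"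
    by (simp add: algebra_simps)
  also have "\<dots> \<le> \<rho> * w + \<rho> * S"
    using assms by (intro add_mono mult_left_mono) auto
  also have "\<dots> \<le> (1 + \<rho>) * w"
    using assms by (simp add: algebra_simps)
  finally show ?thesis using assms(1) by (simp add: field_simps)
qed

lemma (in abelian_group) finsum_remove:
  assumes "finite I" "T \<in> I" "f \<in> I \<rightarrow> carrier G"
  shows "(\<Oplus>i\<in>I. f i) = f T \<oplus> (\<Oplus>i\<in>I - {T}. f i)"
proof -
  have "(\<Oplus>i\<in>insert T (I - {T}). f i) = f T \<oplus> (\<Oplus>i\<in>I - {T}. f i)"
    using assms by (intro finsum_insert) auto
  moreover have "insert T (I - {T}) = I" using assms(2) by blast
  ultimately show ?thesis by simp
qed

lemma (in abelian_group) finsum_diff: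
  assumes f: "f \<in> I \<rightarrow> carrier G" and g: "g \<in> I \<rightarrow> carrier G"
  shows "(\<Oplus>i\<in>I. f i \<ominus> g i) = (\<Oplus>i\<in>I. f i) \<ominus> (\<Oplus>i\<in>I. g i)"
proof -
  have fg: "(\<lambda>i. f i \<ominus> g i) \<in> I \<rightarrow> carrier G" using assms by auto
  have "(\<Oplus>i\<in>I. f i \<ominus> g i) \<oplus> (\<Oplus>i\<in>I. g i) = (\<Oplus>i\<in>I. f i \<ominus> g i \<oplus> g i)"
    using finsum_addf[OF fg g] by simp
  also have "\<dots> = (\<Oplus>i\<in>I. f i)"
  proof (intro finsum_cong')
    fix i assume "i \<in> I"
    then have "f i \<in> carrier G" "g i \<in> carrier G" using assms by auto
    then show "f i \<ominus> g i \<oplus> g i = f i" by (simp add: minus_eq a_assoc l_neg)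
  qed (use f in auto)
  finally have sum: "(\<Oplus>i\<in>I. f i \<ominus> g i) \<oplus> (\<Oplus>i\<in>I. g i) = (\<Oplus>i\<in>I. f i)" .
  have "(\<Oplus>i\<in>I. f i \<ominus> g i) = (\<Oplus>i\<in>I. f i \<ominus> g i) \<oplus> (\<Oplus>i\<in>I. g i) \<ominus> (\<Oplus>i\<in>I. g i)"
    using finsum_closed[OF fg] finsum_closed[OF g] by (simp add: minus_eq a_assoc r_neg)
  then show ?thesis unfolding sum .
qed

lemma (in abelian_group) finsum_diff_except:
  assumes I: "finite I" "T \<in> I" and f: "f \<in> I \<rightarrow> carrier G" and g: "g \<in> I \<rightarrow> carrier G"
    and fT: "f T = \<zero>" and eq: "(\<Oplus>i\<in>I. f i) = (\<Oplus>i\<in>I. g i)"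
  shows "(\<Oplus>i\<in>I. if i = T then \<zero> else f i \<ominus> g i) = g T"
proof -
  let ?F = "\<Oplus>i\<in>I - {T}. f i" and ?G = "\<Oplus>i\<in>I - {T}. g i"
  have FG: "?F \<in> carrier G" "?G \<in> carrier G" "g T \<in> carrier G"
    using f g I by (auto simp: Pi_iff intro!: finsum_closed)
  have "?F = g T \<oplus> ?G"
    using eq finsum_remove[OF I f] finsum_remove[OF I g] fT FG by simp
  have fg: "(\<lambda>i. f i \<ominus> g i) \<in> I - {T} \<rightarrow> carrier G" using f g by auto
  have "(\<Oplus>i\<in>I. if i = T then \<zero> else f i \<ominus> g i)
      = \<zero> \<oplus> (\<Oplus>i\<in>I - {T}. if i = T then \<zero> else f i \<ominus> g i)"
    using I fg by (subst finsum_remove) (auto simp: Pi_iff)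
  also have "(\<Oplus>i\<in>I - {T}. if i = T then \<zero> else f i \<ominus> g i) = (\<Oplus>i\<in>I - {T}. f i \<ominus> g i)"
    using fg by (intro finsum_cong') auto
  also have "\<zero> \<oplus> (\<Oplus>i\<in>I - {T}. f i \<ominus> g i) = (\<Oplus>i\<in>I - {T}. f i \<ominus> g i)"
    using fg by simp
  also have "\<dots> = ?F \<ominus> ?G"
    using f g by (intro finsum_diff) auto
  also have "\<dots> = g T"
    using \<open>?F = g T \<oplus> ?G\<close> FG by (simp add: minus_eq a_assoc r_neg)
  finally show ?thesis .
qed

locale subcode_data = coeff_arrays +
  fixes T :: nat and C :: "nat \<Rightarrow> (nat \<Rightarrow> nat) set" and C' :: "(nat \<Rightarrow> nat) set"
    and P :: "(nat \<Rightarrow> nat) \<Rightarrow> nat \<Rightarrow> nat" and j0 :: nat and \<phi> :: "(nat \<Rightarrow> nat) \<Rightarrow> nat"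
  assumes T_less: "T < t"
    and codes: "\<And>i. i < t \<Longrightarrow> lin_code R (ns i) (C i)"
    and subcode: "C' \<subseteq> C T"
    and proj: "lin_endo R (ns T) P"
    and proj_range: "\<And>v. v \<in> vecs R (ns T) \<Longrightarrow> P v \<in> C'"
    and proj_fix: "\<And>u. u \<in> C' \<Longrightarrow> P u = u"
    and check: "lin_form R (ns T) \<phi>"
    and j0: "j0 < ns T"
    and check_j0: "\<phi> (unit_vec R j0) = \<one>"
    and check_ker: "\<And>v. v \<in> C T \<Longrightarrow> \<phi> v = \<zero>"
begin

definition residual_slice :: "nat \<Rightarrow> ((nat \<Rightarrow> nat) \<Rightarrow> nat) \<Rightarrow> (nat \<Rightarrow> nat) \<Rightarrow> nat" where
  "residual_slice j = map_columns R ns t T (\<lambda>v k. (v j \<ominus> P v j) \<otimes> unit_vec R j0 k)"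

definition check_slice :: "nat \<Rightarrow> ((nat \<Rightarrow> nat) \<Rightarrow> nat) \<Rightarrow> (nat \<Rightarrow> nat) \<Rightarrow> nat" where
  "check_slice j = map_columns R ns t T (\<lambda>v k. \<phi> v \<otimes> unit_vec R j k)"

definition correction :: "(nat \<Rightarrow> nat \<Rightarrow> (nat \<Rightarrow> nat) \<Rightarrow> nat) \<Rightarrow> nat \<Rightarrow> (nat \<Rightarrow> nat) \<Rightarrow> nat" where
  "correction E i = (\<lambda>p. \<Oplus>j\<in>{..<ns T}. check_slice j (E j i) p)"

definition adjusted :: "(nat \<Rightarrow> (nat \<Rightarrow> nat) \<Rightarrow> nat) \<Rightarrow> (nat \<Rightarrow> nat \<Rightarrow> (nat \<Rightarrow> nat) \<Rightarrow> nat)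
    \<Rightarrow> nat \<Rightarrow> (nat \<Rightarrow> nat) \<Rightarrow> nat" where
  "adjusted cs E i = (if i = T then map_columns R ns t T P (cs T) else (\<lambda>p. cs i p \<oplus> correction E i p))"

lemma lin_endo_residual: "lin_endo R (ns T) (\<lambda>v k. (v j \<ominus> P v j) \<otimes> unit_vec R j0 k)"
  by (intro lin_endo_outer lin_form_diff lin_form_coord lin_endo_coord[OF proj] unit_vec_vecs j0)

lemma lin_endo_check: "j < ns T \<Longrightarrow> lin_endo R (ns T) (\<lambda>v k. \<phi> v \<otimes> unit_vec R j k)"
  by (intro lin_endo_outer check unit_vec_vecs)

lemma proj_carrier [simp]: "v \<in> vecs R (ns T) \<Longrightarrow> P v k \<in> carrier R"
  by (rule lin_endo_carrier[OF proj])

lemma check_carrier [simp]: "v \<in> vecs R (ns T) \<Longrightarrow> \<phi> v \<in> carrier R"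
  by (rule lin_form_carrier[OF check])

lemma subcode_carrier [simp]: "v \<in> C' \<Longrightarrow> v k \<in> carrier R"
  using subcode lin_code_carrier[OF codes[OF T_less]] by blast

lemma residual_slice_arrays [simp]: "x \<in> Arr \<Longrightarrow> residual_slice j x \<in> Arr"
  unfolding residual_slice_def by (rule map_columns_arrays[OF T_less lin_endo_residual])

lemma dir_code_subcode: "x \<in> dir_code R ns t (C(T := C')) i \<Longrightarrow> x \<in> dir_code R ns t C i"
  using subcode unfolding dir_code_def by (cases "i = T") auto

lemma dir_code_update_other: "i \<noteq> T \<Longrightarrow> dir_code R ns t (C(T := C')) i = dir_code R ns t C i"
  unfolding dir_code_def by simp

lemma residual_slice_sum_code:
  assumes a: "\<And>i. i < t \<Longrightarrow> a i \<in> dir_code R ns t (C(T := C')) i"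
    and cs: "\<And>i. i < t \<Longrightarrow> cs i \<in> dir_code R ns t C i"
    and sum: "arr_sum R t a = arr_sum R t cs"
  shows "residual_slice j (cs T) \<in> sum_code R ns t C"
proof -
  let ?G = "residual_slice j"
  note G_finsum = map_columns_finsum[OF T_less lin_endo_residual, folded residual_slice_def]
  have aa: "\<And>i. i < t \<Longrightarrow> a i \<in> Arr" and ca: "\<And>i. i < t \<Longrightarrow> cs i \<in> Arr"
    using a cs dir_code_arrays by blast+
  have GaT: "?G (a T) = (\<lambda>_. \<zero>)"
    unfolding residual_slice_def
    using a[OF T_less] proj_fix by (intro map_columns_vanish[OF T_less lin_endo_residual]) (auto simp: minus_eq r_neg)
  have G_sum: "(\<lambda>p. \<Oplus>i\<in>{..<t}. ?G (a i) p) = (\<lambda>p. \<Oplus>i\<in>{..<t}. ?G (cs i) p)"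
    using G_finsum[of "{..<t}" a] G_finsum[of "{..<t}" cs] aa ca sum unfolding arr_sum_def by simp
  text \<open>Since \<open>?G\<close> kills \<open>a T\<close>, comparing the images of the two decompositions writes \<open>?G (cs T)\<close>
    as a sum of terms from the other directions.\<close>
  define xs where "xs i = (\<lambda>p. if i = T then \<zero> else ?G (a i) p \<ominus> ?G (cs i) p)" for i
  have xs: "xs i \<in> dir_code R ns t C i" if "i < t" for i
  proof (cases "i = T")
    case False
    with that show ?thesis unfolding xs_def residual_slice_def
      using a[OF that] cs[OF that] codes[OF that]
      by (auto intro!: dir_code_diff map_columns_dir_code[OF T_less lin_endo_residual] dest: dir_code_subcode)
  qed (simp add: xs_def dir_code_zero[where C=C and i=T, OF codes[OF T_less]])
  have sum_xs: "arr_sum R t xs = ?G (cs T)"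
  proof
    fix p
    show "arr_sum R t xs p = ?G (cs T) p"
      unfolding arr_sum_def xs_def
      by (rule finsum_diff_except) (use T_less aa ca fun_cong[OF G_sum, of p] GaT in auto)
  qed
  show ?thesis
    unfolding sum_code_def mem_Collect_eq by (rule exI[of _ xs]) (use xs sum_xs in simp)
qed

lemma check_slice_arrays [simp]: "j < ns T \<Longrightarrow> x \<in> Arr \<Longrightarrow> check_slice j x \<in> Arr"
  unfolding check_slice_def by (rule map_columns_arrays[OF T_less lin_endo_check])

context
  fixes E :: "nat \<Rightarrow> nat \<Rightarrow> (nat \<Rightarrow> nat) \<Rightarrow> nat" and i :: nat
  assumes E: "\<And>j. j < ns T \<Longrightarrow> E j i \<in> Arr"
begin

lemma correction_apply:
  assumes p: "p \<in> Pos"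
  shows "correction E i p = \<phi> (col (E (p T) i) T p)"
proof -
  have "correction E i p = (\<Oplus>j\<in>{..<ns T}. if p T = j then \<phi> (col (E j i) T p) else \<zero>)"
    unfolding correction_def check_slice_def using p E
    by (intro finsum_cong') (auto simp: map_columns_apply[OF T_less] unit_vec_def)
  also have "\<dots> = \<phi> (col (E (p T) i) T p)"
    using p T_less E by (intro finsum_singleton) auto
  finally show ?thesis .
qed

lemma correction_outside: "p \<notin> Pos \<Longrightarrow> correction E i p = \<zero>"
  unfolding correction_def check_slice_def
  by (intro add.finprod_one_eqI) (simp add: map_columns_outside[OF T_less])

lemma correction_arrays [simp]: "correction E i \<in> Arr"
  unfolding correction_def using E by (intro arrays_finsum) auto

lemma col_weight_correction_le:
  assumes "i < t" "i \<noteq> T"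
  shows "col_weight R ns t (correction E i) i \<le> (\<Sum>j<ns T. col_weight R ns t (E j i) i)"
proof -
  have "col_weight R ns t (correction E i) i \<le> (\<Sum>j<ns T. col_weight R ns t (check_slice j (E j i)) i)"
    unfolding correction_def by (rule col_weight_finsum_le) simp
  also have "\<dots> \<le> (\<Sum>j<ns T. col_weight R ns t (E j i) i)"
    unfolding check_slice_def using assms E
    by (intro sum_mono col_weight_map_columns_slice_le[OF T_less lin_endo_check]) (auto simp: unit_vec_def)
  finally show ?thesis .
qed

end

lemma correction_vanish:
  assumes "\<And>j. j < ns T \<Longrightarrow> E j T \<in> dir_code R ns t C T"
  shows "correction E T = (\<lambda>_. \<zero>)"
proof -
  have "check_slice j (E j T) = (\<lambda>_. \<zero>)" if "j < ns T" for j
    unfolding check_slice_def using assms that check_ker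
    by (intro map_columns_vanish[OF T_less lin_endo_check]) auto
  then show ?thesis unfolding correction_def by (intro ext add.finprod_one_eqI) simp
qed

lemma correction_dir_code:
  assumes i: "i < t" "i \<noteq> T" and E: "\<And>j. j < ns T \<Longrightarrow> E j i \<in> dir_code R ns t C i"
  shows "correction E i \<in> dir_code R ns t C i"
  unfolding correction_def check_slice_def using codes[OF i(1)] i E
  by (intro dir_code_finsum map_columns_dir_code[OF T_less lin_endo_check]) auto

lemma arr_sum_correction:
  assumes E: "\<And>j i. j < ns T \<Longrightarrow> i < t \<Longrightarrow> E j i \<in> Arr"
    and dec: "\<And>j. j < ns T \<Longrightarrow> arr_sum R t (E j) = residual_slice j (cs T)"
    and cs: "cs T \<in> Arr"
  shows "arr_sum R t (correction E) = (\<lambda>p. cs T p \<ominus> map_columns R ns t T P (cs T) p)"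
proof
  fix p
  show "arr_sum R t (correction E) p = cs T p \<ominus> map_columns R ns t T P (cs T) p"
  proof (cases "p \<in> Pos")
    case False
    then have "\<And>i. i \<in> {..<t} \<Longrightarrow> correction E i p = \<zero>"
      using E by (simp add: correction_outside)
    then show ?thesis
      unfolding arr_sum_def using False cs
      by (simp add: map_columns_outside[OF T_less] arrays_outside minus_eq) (rule add.finprod_one_eqI, simp)
  next
    case True
    let ?c = "col (cs T) T p"
    have pT: "p T < ns T" using True T_less by simp
    have "arr_sum R t (correction E) p = (\<Oplus>i\<in>{..<t}. \<phi> (col (E (p T) i) T p))"
      unfolding arr_sum_def using E pT by (intro finsum_cong') (auto simp: correction_apply True)
    also have "\<dots> = \<phi> (col (arr_sum R t (E (p T))) T p)"
      unfolding arr_sum_def column_finsum using E pT by (intro lin_form_finsum[OF check, symmetric]) auto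
    also have "\<dots> = \<phi> (\<lambda>k. (?c (p T) \<ominus> P ?c (p T)) \<otimes> unit_vec R j0 k)"
      unfolding dec[OF pT] residual_slice_def using column_map_columns[OF T_less lin_endo_residual cs True] by simp
    also have "\<dots> = (?c (p T) \<ominus> P ?c (p T)) \<otimes> \<phi> (unit_vec R j0)"
      using j0 cs pT by (intro lin_form_homogeneous[OF check]) simp_all
    also have "\<dots> = cs T p \<ominus> map_columns R ns t T P (cs T) p"
      using check_j0 True cs proj pT by (simp add: map_columns_apply[OF T_less])
    finally show ?thesis .
  qed
qed

lemma adjusted_dir_code:
  assumes cs: "\<And>i. i < t \<Longrightarrow> cs i \<in> dir_code R ns t C i"
    and E: "\<And>j i. j < ns T \<Longrightarrow> i < t \<Longrightarrow> E j i \<in> dir_code R ns t C i"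
    and i: "i < t"
  shows "adjusted cs E i \<in> dir_code R ns t (C(T := C')) i"
proof (cases "i = T")
  case True
  then show ?thesis
    unfolding adjusted_def using cs[OF T_less] proj_range
    by (auto intro: map_columns_dir_code_range[OF T_less proj] dest: dir_code_arrays)
next
  case False
  then show ?thesis
    unfolding adjusted_def dir_code_update_other[OF False] using cs[OF i] E i
    by (auto intro!: dir_code_add[where C=C and i=i, OF codes[OF i]] correction_dir_code)
qed

lemma arr_sum_adjusted:
  assumes cs: "\<And>i. i < t \<Longrightarrow> cs i \<in> Arr"
    and E: "\<And>j i. j < ns T \<Longrightarrow> i < t \<Longrightarrow> E j i \<in> dir_code R ns t C i"
    and dec: "\<And>j. j < ns T \<Longrightarrow> arr_sum R t (E j) = residual_slice j (cs T)"
  shows "arr_sum R t (adjusted cs E) = arr_sum R t cs"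
proof
  fix p
  let ?I = "{..<t} - {T}" and ?Q = "map_columns R ns t T P (cs T) p"
  have Ea: "\<And>j i. j < ns T \<Longrightarrow> i < t \<Longrightarrow> E j i \<in> Arr" using E dir_code_arrays by blast
  have I: "finite {..<t}" "T \<in> {..<t}" using T_less by auto
  have corr_T: "correction E T = (\<lambda>_. \<zero>)"
    by (rule correction_vanish) (use E T_less in auto)
  have "arr_sum R t (correction E) = (\<lambda>p. cs T p \<ominus> map_columns R ns t T P (cs T) p)"
    by (rule arr_sum_correction) (use Ea dec cs T_less in auto)
  then have "arr_sum R t (correction E) p = cs T p \<ominus> ?Q" by simp
  then have "correction E T p \<oplus> (\<Oplus>i\<in>?I. correction E i p) = cs T p \<ominus> ?Q"
    unfolding arr_sum_def using Ea by (subst (asm) finsum_remove[OF I]) auto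
  then have corr_sum: "(\<Oplus>i\<in>?I. correction E i p) = cs T p \<ominus> ?Q"
    unfolding corr_T using Ea by (simp add: finsum_closed)
  have corr_c: "correction E i q \<in> carrier R" if "i < t" for i q
  proof -
    have "correction E i \<in> Arr" using Ea that by (intro correction_arrays)
    then show ?thesis by simp
  qed
  have cs_c: "\<And>i q. i < t \<Longrightarrow> cs i q \<in> carrier R" using cs by simp
  have "(\<Oplus>i\<in>?I. adjusted cs E i p) = (\<Oplus>i\<in>?I. cs i p \<oplus> correction E i p)"
    by (intro finsum_cong') (auto simp: adjusted_def corr_c cs_c)
  also have "\<dots> = (\<Oplus>i\<in>?I. cs i p) \<oplus> (\<Oplus>i\<in>?I. correction E i p)"
    by (intro finsum_addf) (auto simp: corr_c cs_c)
  finally have "(\<Oplus>i\<in>?I. adjusted cs E i p) = (\<Oplus>i\<in>?I. cs i p) \<oplus> (cs T p \<ominus> ?Q)"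
    using corr_sum by simp
  moreover have "(\<Oplus>i\<in>?I. cs i p) \<in> carrier R" "?Q \<in> carrier R" "cs T p \<in> carrier R"
    using cs_c T_less map_columns_arrays[OF T_less proj cs[OF T_less]] by (auto intro: finsum_closed)
  moreover have "adjusted cs E i p \<in> carrier R" if "i < t" for i
    using that cs_c corr_c map_columns_arrays[OF T_less proj cs[OF T_less]] by (simp add: adjusted_def)
  ultimately show "arr_sum R t (adjusted cs E) p = arr_sum R t cs p"
    unfolding arr_sum_def using cs_c
    by (simp add: finsum_remove[OF I] Pi_iff adjusted_def minus_eq a_lcomm[of ?Q] r_neg r_neg2 a_comm)
qed

lemma col_weight_adjusted_le:
  assumes cs: "\<And>i. i < t \<Longrightarrow> cs i \<in> Arr" and E: "\<And>j i. j < ns T \<Longrightarrow> i < t \<Longrightarrow> E j i \<in> Arr"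
    and i: "i < t"
  shows "col_weight R ns t (adjusted cs E i) i
    \<le> col_weight R ns t (cs i) i + (\<Sum>j<ns T. col_weight R ns t (E j i) i)"
proof (cases "i = T")
  case True
  then show ?thesis
    unfolding adjusted_def using col_weight_map_columns_le[OF T_less proj cs[OF T_less]] by simp
next
  case False
  have "col_weight R ns t (adjusted cs E i) i
      \<le> col_weight R ns t (cs i) i + col_weight R ns t (correction E i) i"
    unfolding adjusted_def using False by (simp add: col_weight_add_le)
  also have "\<dots> \<le> col_weight R ns t (cs i) i + (\<Sum>j<ns T. col_weight R ns t (E j i) i)"
    using col_weight_correction_le[of E i] E i False by simp
  finally show ?thesis .
qed

lemma weight_residual_slice_le: "x \<in> Arr \<Longrightarrow> weight R ns t (residual_slice j x) \<le> col_weight R ns t x T"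
  unfolding residual_slice_def
  by (rule weight_map_columns_slice_le[OF T_less lin_endo_residual, of j0]) (auto simp: unit_vec_def)

lemma adjusted_weight_bound:
  fixes \<rho> w :: real
  assumes \<rho>: "\<rho> > 0"
    and cs: "\<And>i. i < t \<Longrightarrow> cs i \<in> Arr" and E: "\<And>j i. j < ns T \<Longrightarrow> i < t \<Longrightarrow> E j i \<in> Arr"
    and cs_bound: "\<rho> * (\<Sum>i<t. real (ns i) * real (col_weight R ns t (cs i) i)) \<le> w"
    and E_bound: "\<And>j. j < ns T \<Longrightarrow>
      \<rho> * (\<Sum>i<t. real (ns i) * real (col_weight R ns t (E j i) i)) \<le> real (weight R ns t (residual_slice j (cs T)))"
  shows "\<rho> * \<rho> / (1 + \<rho>) * (\<Sum>i<t. real (ns i) * real (col_weight R ns t (adjusted cs E i) i)) \<le> w"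
proof (rule subcode_expansion_arith[OF \<rho> cs_bound])
  let ?S = "\<Sum>i<t. real (ns i) * real (col_weight R ns t (cs i) i)"
  let ?Y = "\<Sum>j<ns T. \<Sum>i<t. real (ns i) * real (col_weight R ns t (E j i) i)"
  have "\<rho> * ?Y = (\<Sum>j<ns T. \<rho> * (\<Sum>i<t. real (ns i) * real (col_weight R ns t (E j i) i)))"
    by (rule sum_distrib_left)
  also have "\<dots> \<le> (\<Sum>j<ns T. real (col_weight R ns t (cs T) T))"
  proof (rule sum_mono)
    fix j assume "j \<in> {..<ns T}"
    then show "\<rho> * (\<Sum>i<t. real (ns i) * real (col_weight R ns t (E j i) i)) \<le> real (col_weight R ns t (cs T) T)"
      using E_bound weight_residual_slice_le[OF cs[OF T_less]] by (meson lessThan_iff of_nat_le_iff order_trans)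
  qed
  also have "\<dots> \<le> ?S"
    using T_less
    by (simp, intro member_le_sum[where f = "\<lambda>i. real (ns i) * real (col_weight R ns t (cs i) i)"]) auto
  finally show "\<rho> * ?Y \<le> ?S" .
  have "(\<Sum>i<t. real (ns i) * real (col_weight R ns t (adjusted cs E i) i))
      \<le> (\<Sum>i<t. real (ns i) * (real (col_weight R ns t (cs i) i) + (\<Sum>j<ns T. real (col_weight R ns t (E j i) i))))"
    using col_weight_adjusted_le[OF cs E] by (intro sum_mono mult_left_mono) (auto simp flip: of_nat_sum of_nat_add)
  also have "\<dots> = ?S + ?Y"
    by (simp add: algebra_simps sum.distrib sum_distrib_left sum.swap[of _ "{..<ns T}"])
  finally show "(\<Sum>i<t. real (ns i) * real (col_weight R ns t (adjusted cs E i) i)) \<le> ?S + ?Y" .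
qed

lemma residual_slice_decompositions:
  assumes pe: "pe_at_least R ns t C \<rho>"
    and a: "\<And>i. i < t \<Longrightarrow> a i \<in> dir_code R ns t (C(T := C')) i"
    and cs: "\<And>i. i < t \<Longrightarrow> cs i \<in> dir_code R ns t C i"
    and sum: "arr_sum R t a = arr_sum R t cs"
  obtains E where "\<And>j i. j < ns T \<Longrightarrow> i < t \<Longrightarrow> E j i \<in> dir_code R ns t C i"
    and "\<And>j. j < ns T \<Longrightarrow> arr_sum R t (E j) = residual_slice j (cs T)"
    and "\<And>j. j < ns T \<Longrightarrow> \<rho> * (\<Sum>i<t. real (ns i) * real (col_weight R ns t (E j i) i))
      \<le> real (weight R ns t (residual_slice j (cs T)))"
proof -
  define good where "good j Ej \<longleftrightarrow> (\<forall>i<t. Ej i \<in> dir_code R ns t C i)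
      \<and> residual_slice j (cs T) = arr_sum R t Ej
      \<and> \<rho> * (\<Sum>i<t. real (ns i) * real (col_weight R ns t (Ej i) i)) \<le> real (weight R ns t (residual_slice j (cs T)))"
    for j Ej
  have "\<exists>Ej. good j Ej" for j
    using pe[unfolded pe_at_least_def, rule_format, OF residual_slice_sum_code[OF a cs sum]]
    unfolding good_def by blast
  then obtain E where "\<forall>j\<in>{..<ns T}. good j (E j)" using bchoice[of "{..<ns T}" good] by blast
  then have good_E: "good j (E j)" if "j < ns T" for j using that by blast
  show ?thesis
  proof
    show "\<And>j i. j < ns T \<Longrightarrow> i < t \<Longrightarrow> E j i \<in> dir_code R ns t C i"
      using good_E unfolding good_def by blast
    show "\<And>j. j < ns T \<Longrightarrow> arr_sum R t (E j) = residual_slice j (cs T)"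
      using good_E unfolding good_def by simp
    show "\<And>j. j < ns T \<Longrightarrow> \<rho> * (\<Sum>i<t. real (ns i) * real (col_weight R ns t (E j i) i))
        \<le> real (weight R ns t (residual_slice j (cs T)))"
      using good_E unfolding good_def by blast
  qed
qed

lemma pe_at_least_update:
  assumes pe: "pe_at_least R ns t C \<rho>" and \<rho>: "\<rho> > 0"
  shows "pe_at_least R ns t (C(T := C')) (\<rho> * \<rho> / (1 + \<rho>))"
  unfolding pe_at_least_def
proof
  fix c assume "c \<in> sum_code R ns t (C(T := C'))"
  then obtain a where a: "\<forall>i<t. a i \<in> dir_code R ns t (C(T := C')) i" and ca: "c = arr_sum R t a"
    unfolding sum_code_def by blast
  then have "c \<in> sum_code R ns t C"
    unfolding sum_code_def mem_Collect_eq by (intro exI[of _ a]) (auto intro: dir_code_subcode)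
  then obtain cs where cs: "\<forall>i<t. cs i \<in> dir_code R ns t C i" and ccs: "c = arr_sum R t cs"
    and cs_bound: "\<rho> * (\<Sum>i<t. real (ns i) * real (col_weight R ns t (cs i) i)) \<le> real (weight R ns t c)"
    using pe unfolding pe_at_least_def by blast
  obtain E where E: "\<And>j i. j < ns T \<Longrightarrow> i < t \<Longrightarrow> E j i \<in> dir_code R ns t C i"
    and dec: "\<And>j. j < ns T \<Longrightarrow> arr_sum R t (E j) = residual_slice j (cs T)"
    and E_bound: "\<And>j. j < ns T \<Longrightarrow> \<rho> * (\<Sum>i<t. real (ns i) * real (col_weight R ns t (E j i) i))
      \<le> real (weight R ns t (residual_slice j (cs T)))"
    using residual_slice_decompositions[OF pe, of a cs] a cs ca ccs by blast
  have csa: "cs i \<in> Arr" if "i < t" for i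
    using dir_code_arrays cs that by blast
  have Ea: "E j i \<in> Arr" if "j < ns T" "i < t" for j i
    using dir_code_arrays[OF E[OF that]] .
  show "\<exists>cs. (\<forall>i<t. cs i \<in> dir_code R ns t (C(T := C')) i) \<and> c = arr_sum R t cs
      \<and> \<rho> * \<rho> / (1 + \<rho>) * (\<Sum>i<t. real (ns i) * real (col_weight R ns t (cs i) i)) \<le> real (weight R ns t c)"
  proof (intro exI conjI allI impI)
    show "adjusted cs E i \<in> dir_code R ns t (C(T := C')) i" if "i < t" for i
      by (rule adjusted_dir_code) (use cs E that in auto)
    show "c = arr_sum R t (adjusted cs E)"
      using arr_sum_adjusted[where cs = cs and E = E, OF csa E dec] ccs by simp
    show "\<rho> * \<rho> / (1 + \<rho>) * (\<Sum>i<t. real (ns i) * real (col_weight R ns t (adjusted cs E i) i))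
        \<le> real (weight R ns t c)"
      by (rule adjusted_weight_bound[OF \<rho> csa Ea cs_bound E_bound])
  qed
qed

end

lemma (in coeff_field) pe_at_least_subcode:
  assumes T: "T < t" and codes: "\<And>i. i < t \<Longrightarrow> lin_code R (ns i) (C i)"
    and proper: "C T \<noteq> vecs R (ns T)"
    and C': "lin_code R (ns T) C'" "C' \<subseteq> C T"
    and pe: "pe_at_least R ns t C \<rho>" and \<rho>: "\<rho> > 0"
  shows "pe_at_least R ns t (C(T := C')) (\<rho> * \<rho> / (1 + \<rho>))"
proof -
  obtain P where P: "lin_endo R (ns T) P" "\<And>v. v \<in> vecs R (ns T) \<Longrightarrow> P v \<in> C'" "\<And>u. u \<in> C' \<Longrightarrow> P u = u"
    using lin_code_projection[OF C'(1)] by blast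
  obtain j0 \<phi> where \<phi>: "j0 < ns T" "lin_form R (ns T) \<phi>" "\<phi> (unit_vec R j0) = \<one>"
    "\<And>v. v \<in> C T \<Longrightarrow> \<phi> v = \<zero>"
    using proper_code_parity_check[OF codes[OF T] proper] by blast
  interpret subcode_data R ns t T C C' P j0 \<phi>
    by unfold_locales (use T codes C' P \<phi> in auto)
  show ?thesis by (rule pe_at_least_update[OF pe \<rho>])
qed

theorem lemmaA2:
  shows "\<forall>\<rho>::real. \<forall>t::nat. \<rho> > 0 \<longrightarrow> t \<ge> 1 \<longrightarrow>
    (\<exists>\<rho>'::real. \<rho>' > 0 \<and>
      (\<forall>(R::nat ring) (n::nat) (C::nat \<Rightarrow> (nat \<Rightarrow> nat) set) (C'::(nat \<Rightarrow> nat) set).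
         field R \<longrightarrow> finite (carrier R) \<longrightarrow> char_two R \<longrightarrow>
         (\<forall>i<t. lin_code R n (C i) \<and> C i \<noteq> vecs R n) \<longrightarrow>
         pe_at_least R (\<lambda>_. n) t C \<rho> \<longrightarrow>
         lin_code R n C' \<longrightarrow> C' \<subseteq> C (t - 1) \<longrightarrow>
         pe_at_least R (\<lambda>_. n) t (C((t - 1) := C')) \<rho>'))"
  apply (intro allI impI)
  subgoal for \<rho> t
  proof (rule exI[of _ "\<rho> * \<rho> / (1 + \<rho>)"], intro conjI allI impI)
    assume \<rho>: "\<rho> > 0" and t: "t \<ge> 1"
    then show "\<rho> * \<rho> / (1 + \<rho>) > 0" by simp
    fix R :: "nat ring" and n C C'
    assume "field R" and codes: "\<forall>i<t. lin_code R n (C i) \<and> C i \<noteq> vecs R n"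
      and pe: "pe_at_least R (\<lambda>_. n) t C \<rho>" and C': "lin_code R n C'" "C' \<subseteq> C (t - 1)"
    interpret coeff_field R
      using \<open>field R\<close> unfolding coeff_field_def coeff_cring_def by (simp add: field.axioms(1) domain.axioms(1))
    show "pe_at_least R (\<lambda>_. n) t (C(t - 1 := C')) (\<rho> * \<rho> / (1 + \<rho>))"
      using t codes by (intro pe_at_least_subcode[OF _ _ _ C' pe \<rho>]) auto
  qed
  done

end
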